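(* Let $(X,E)$ be an undirected simple graph with finite nonempty vertex set $X$, let $Y$ be a finite set and let $F:X\to 2^Y$ be a set-valued mapping. The following statements are equivalent: (i) $F$ satisfies the generalized Hall condition. (ii) $F$ admits a disparate selection.
   Context: Setting. $(X,E)$ is an undirected simple graph with finite vertex set $X$, $Y$ is a finite set, $F:X\to 2^Y$ is a set-valued mapping (empty images are allowed). $\sharp$ denotes cardinality; $\subset$ allows equality. $G(F)=\{(x,y)\in X\times Y\mid y\in F(x)\}$ is the graph of $F$; $F_{|W}$ is the restriction of $F$ to $W\subset X$. A submapping of $F$ is a set-valued mapping $F'$ on the same domain with $G(F')\subset G(F)$. A selection of $F$ is a map $s:X\to Y$ with $s(x)\in F(x)$ for all $x\in X$. Disparate. Points $(x,y),(x',y')\in X\times Y$ are disparate if $(x,y)\ne(x',y')$ and ($y=y'$ implies $\{x,x'\}\notin E$). A set $A\subset X\times Y$ is disparate if any two distinct points of $A$ are disparate. A selection $s$ is disparate if $G(s)=\{(x,s(x))\mid x\in X\}$ is a disparate set. For $A\subset X\times Y$: $hull(A)=\{a\in X\times Y\mid$ there is $a'\in A$ such that $a,a'$ are not disparate$\}$ and $compl(A)=\{a\in X\times Y\mid a,a'$ are disparate for every $a'\in A\}$. Complement mapping. For $W\subset X$ and $Z\subset W\times Y$, $F_{W,Z}:X\setminus W\to 2^Y$ is defined by $G(F_{W,Z})=G(F_{|X\setminus W})\cap compl(Z)$. Convention. For a mapping defined on a subset $X'\subset X$, all notions are understood with $X'$ and the subgraph of $(X,E)$ induced by $X'$ in place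 of $X$ and $(X,E)$. Collections. A collection of $F$ is a family $\mathcal H=(A_V)$ indexed by the nonempty sets $V\subset X$, with $A_V\subset G(F_{|V})$. It is a Hall collection if every $A_V$ is disparate and $\sharp A_V\ge\sharp V$. For $W\subset X$, $\mathcal H_{|W}$ is the family of the $A_V$ with $\emptyset\ne V\subset W$ (a collection of $F_{|W}$), and $\mathcal H_W$ is the family, indexed by the nonempty $V\subset X\setminus W$, of the sets $A_{W\cup V}\cap compl(\bigcup_{A\in\mathcal H_{|W}}A)\cap(V\times Y)$ (a collection of $F_{|X\setminus W}$). For nonempty $W$, $F^{\mathcal H_W}$ is the submapping of $F_{|W}$ with graph $G(F_{|W})\cap compl(\bigcup_{A\in\mathcal H_W}A)$. For nonempty $W$, $\mathcal H$ is $W$-distributed if for every nonempty $V\subset X\setminus W$, $$\sharp\Bigl(A_{W\cup V}\cap\bigl((W\times Y)\cup(hull(\textstyle\bigcup_{A\in\mathcal H_{|W}}A)\cap(V\times Y))\bigr)\Bigr)\le\sharp W .$$ Cascades. For a tuple $(W_1,\dots,W_k)$, $k\ge1$, of subsets of $W_0=X$ put $W_0^c=W_0$ and, for $i=1,\dots,k$, $W_i^c=W_{i-1}\setminus W_i$ if $W_i\subset W_{i-1}$, and $W_i^c=W_{i-1}^c\setminus W_i$ otherwise. The tuple is a cascade in $X$ if $W_i\subset W_{i-1}$ or $W_i\subset W_{i-1}^c$ for $i=1,\dots,k$. Put $pre(i)=W_{i-1}$ if $W_i\subset W_{i-1}$ and $pre(i)=W_{i-1}^c$ if $W_i\subset W_{i-1}^c$.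 Given a collection $\mathcal H$ of $F$ and a cascade, put $\mathcal H(W_1,\dots,W_0)=\mathcal H$, $F(W_1,\dots,W_0)=F$ and inductively for $i=1,\dots,k-1$, writing $\mathcal H'=\mathcal H(W_1,\dots,W_{i-1})$, $F'=F(W_1,\dots,W_{i-1})$ and $\tilde F=F'^{\,\mathcal H'_{W_i}}$: if $W_{i+1}\subset W_i$, then $\mathcal H(W_1,\dots,W_i)=\mathcal H'_{|W_i}$ and $F(W_1,\dots,W_i)=\tilde F$; if $W_{i+1}\subset W_i^c$, then $\mathcal H(W_1,\dots,W_i)=\mathcal H'_{W_i}$ and $F(W_1,\dots,W_i)=F'_{W_i,G(\tilde F)}$. Here $F(W_1,\dots,W_{i-1})$ is a mapping on $pre(i)$ and $\mathcal H(W_1,\dots,W_{i-1})$ is a collection of it. Generalized Hall condition (recursion on $\sharp X\ge 1$). If $\sharp X=1$, $F$ satisfies it if $G(F)\ne\emptyset$. Let $\sharp X>1$ and suppose the condition is defined for mappings on smaller vertex sets. - A nonempty $W\subset X$ is a generalized critical set of $F$ if there is $(x,y)\in(X\setminus W)\times Y$ such that $(F_{\{x\},\{(x,y)\}})_{|W}$ does not satisfy the generalized Hall condition. It is minimal if no proper subset of $W$ is a generalized critical set of $F$. - For a Hall collection $\mathcal H$ of $F$, a cascade $(W_1,\dots,W_k)$ in $X$ is a primitive $(F,\mathcal H)$-critical cascade if $W_i$ is a minimal generalized critical set of $F(W_1,\dots,W_{i-1})$ for $i=1,\dots,k$. - A Hall collection $\mathcal H$ of $F$ is distributed if for each primitive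 $(F,\mathcal H)$-critical cascade $(W_1,\dots,W_k)$ in $X$ the collection $\mathcal H(W_1,\dots,W_{i-1})$ of $F(W_1,\dots,W_{i-1})$ is $W_i$-distributed for $i=1,\dots,k$. - $F$ satisfies the generalized Hall condition if $F$ admits a distributed Hall collection. *)

theory Defs
  imports Main
begin

text \<open>
  A set-valued mapping on a vertex set \<open>X\<close> is a function \<open>F :: 'a \<Rightarrow> 'b set\<close> of which only the values
  on \<open>X\<close> matter; its graph is \<open>Sigma X F\<close>, and the graph of its restriction to \<open>W\<close> is
  \<open>Sigma W F\<close>. The domain is always passed explicitly.  Likewise, a family indexed by the nonempty
  subsets of \<open>X\<close> is a function on all sets of which only the values at nonempty subsets of \<open>X\<close>
  matter; restricting a mapping or a family to \<open>W\<close> therefore changes only the domain that is passed.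

  The edge set \<open>E\<close> is never replaced by that of an induced subgraph: disparateness of two points of
  \<open>W \<times> Y\<close> consults only edges inside \<open>W\<close>.
\<close>

definition simple_graph :: "'a set \<Rightarrow> 'a set set \<Rightarrow> bool" where
  "simple_graph X E \<longleftrightarrow> (\<forall>e\<in>E. e \<subseteq> X \<and> card e = 2)"

context
  fixes E :: "'a set set" and Y :: "'b set"
begin

definition disparate :: "'a \<times> 'b \<Rightarrow> 'a \<times> 'b \<Rightarrow> bool" where
  "disparate a a' \<longleftrightarrow> a \<noteq> a' \<and> (snd a = snd a' \<longrightarrow> {fst a, fst a'} \<notin> E)"

definition disparate_set :: "('a \<times> 'b) set \<Rightarrow> bool" where
  "disparate_set A \<longleftrightarrow> (\<forall>a\<in>A. \<forall>a'\<in>A. a \<noteq> a' \<longrightarrow> disparate a a')"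

definition selection :: "'a set \<Rightarrow> ('a \<Rightarrow> 'b set) \<Rightarrow> ('a \<Rightarrow> 'b) \<Rightarrow> bool" where
  "selection X F s \<longleftrightarrow> (\<forall>x\<in>X. s x \<in> F x)"

definition disparate_selection :: "'a set \<Rightarrow> ('a \<Rightarrow> 'b set) \<Rightarrow> ('a \<Rightarrow> 'b) \<Rightarrow> bool" where
  "disparate_selection X F s \<longleftrightarrow> selection X F s \<and> disparate_set ((\<lambda>x. (x, s x)) ` X)"

definition disp_hull :: "'a set \<Rightarrow> ('a \<times> 'b) set \<Rightarrow> ('a \<times> 'b) set" where
  "disp_hull X A = {a \<in> X \<times> Y. \<exists>a'\<in>A. \<not> disparate a a'}"

definition disp_compl :: "'a set \<Rightarrow> ('a \<times> 'b) set \<Rightarrow> ('a \<times> 'b) set" where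
  "disp_compl X A = {a \<in> X \<times> Y. \<forall>a'\<in>A. disparate a a'}"

text \<open>\<open>F\<^bsub>W,Z\<^esub>\<close> for a mapping \<open>F\<close> on \<open>X\<close>; the result is a mapping on \<open>X - W\<close>.\<close>

definition compl_map ::
    "'a set \<Rightarrow> 'a set \<Rightarrow> ('a \<times> 'b) set \<Rightarrow> ('a \<Rightarrow> 'b set) \<Rightarrow> 'a \<Rightarrow> 'b set" where
  "compl_map X W Z F = (\<lambda>x. {y. (x, y) \<in> Sigma (X - W) F \<inter> disp_compl X Z})"


subsection \<open>Collections\<close>

definition collection :: "'a set \<Rightarrow> ('a \<Rightarrow> 'b set) \<Rightarrow> ('a set \<Rightarrow> ('a \<times> 'b) set) \<Rightarrow> bool" where
  "collection X F H \<longleftrightarrow> (\<forall>V. V \<noteq> {} \<and> V \<subseteq> X \<longrightarrow> H V \<subseteq> Sigma V F)"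

definition hall_collection :: "'a set \<Rightarrow> ('a \<Rightarrow> 'b set) \<Rightarrow> ('a set \<Rightarrow> ('a \<times> 'b) set) \<Rightarrow> bool" where
  "hall_collection X F H \<longleftrightarrow> collection X F H \<and>
     (\<forall>V. V \<noteq> {} \<and> V \<subseteq> X \<longrightarrow> disparate_set (H V) \<and> card (H V) \<ge> card V)"

definition coll_Union :: "'a set \<Rightarrow> ('a set \<Rightarrow> ('a \<times> 'b) set) \<Rightarrow> ('a \<times> 'b) set" where
  "coll_Union W H = (\<Union>V \<in> {V. V \<noteq> {} \<and> V \<subseteq> W}. H V)"

text \<open>\<open>\<H>\<^sub>W\<close> for a collection \<open>\<H>\<close> of a mapping on \<open>X\<close>; the result lives on \<open>X - W\<close>.\<close>

definition compl_coll ::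
    "'a set \<Rightarrow> 'a set \<Rightarrow> ('a set \<Rightarrow> ('a \<times> 'b) set) \<Rightarrow> 'a set \<Rightarrow> ('a \<times> 'b) set" where
  "compl_coll X W H = (\<lambda>V. H (W \<union> V) \<inter> disp_compl X (coll_Union W H) \<inter> V \<times> Y)"

text \<open>The submapping of the restriction of \<open>F\<close> to \<open>W\<close> determined by \<open>\<H>\<^sub>W\<close>, where \<open>F\<close> is a mapping
  on \<open>X\<close> with collection \<open>\<H>\<close>.\<close>

definition sub_map ::
    "'a set \<Rightarrow> 'a set \<Rightarrow> ('a set \<Rightarrow> ('a \<times> 'b) set) \<Rightarrow> ('a \<Rightarrow> 'b set) \<Rightarrow> 'a \<Rightarrow> 'b set" where
  "sub_map X W H F =
     (\<lambda>x. {y. (x, y) \<in> Sigma W F \<inter> disp_compl X (coll_Union (X - W) (compl_coll X W H))})"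

definition set_distributed :: "'a set \<Rightarrow> 'a set \<Rightarrow> ('a set \<Rightarrow> ('a \<times> 'b) set) \<Rightarrow> bool" where
  "set_distributed X W H \<longleftrightarrow>
     (\<forall>V. V \<noteq> {} \<and> V \<subseteq> X - W \<longrightarrow>
        card (H (W \<union> V) \<inter> (W \<times> Y \<union> (disp_hull X (coll_Union W H) \<inter> V \<times> Y))) \<le> card W)"


subsection \<open>Cascades\<close>

text \<open>A tuple \<open>(W\<^sub>1, \<dots>, W\<^sub>k)\<close> is the list \<open>ws\<close> of length \<open>k\<close>; \<open>casc_set X ws i\<close> is \<open>W\<^sub>i\<close>, including
  \<open>W\<^sub>0 = X\<close>, \<open>casc_co X ws i\<close> is the complementary set of index \<open>i\<close>, and \<open>casc_pre X ws i\<close> is \<open>pre(i)\<close>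
  for \<open>i \<ge> 1\<close>.\<close>

definition casc_set :: "'a set \<Rightarrow> 'a set list \<Rightarrow> nat \<Rightarrow> 'a set" where
  "casc_set X ws i = (X # ws) ! i"

primrec casc_co :: "'a set \<Rightarrow> 'a set list \<Rightarrow> nat \<Rightarrow> 'a set" where
  "casc_co X ws 0 = X"
| "casc_co X ws (Suc i) =
     (if casc_set X ws (Suc i) \<subseteq> casc_set X ws i
      then casc_set X ws i - casc_set X ws (Suc i)
      else casc_co X ws i - casc_set X ws (Suc i))"

definition cascade :: "'a set \<Rightarrow> 'a set list \<Rightarrow> bool" where
  "cascade X ws \<longleftrightarrow> ws \<noteq> [] \<and> (\<forall>W\<in>set ws. W \<subseteq> X) \<and>
     (\<forall>i\<in>{1..length ws}. casc_set X ws i \<subseteq> casc_set X ws (i - 1) \<or>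
                         casc_set X ws i \<subseteq> casc_co X ws (i - 1))"

definition casc_pre :: "'a set \<Rightarrow> 'a set list \<Rightarrow> nat \<Rightarrow> 'a set" where
  "casc_pre X ws i =
     (if casc_set X ws i \<subseteq> casc_set X ws (i - 1) then casc_set X ws (i - 1)
      else casc_co X ws (i - 1))"

text \<open>\<open>casc_coll X ws H i\<close> and \<open>casc_map X ws H F i\<close> are \<open>\<H>(W\<^sub>1, \<dots>, W\<^sub>i)\<close> and \<open>F(W\<^sub>1, \<dots>, W\<^sub>i)\<close>, which
  live on \<open>pre(i + 1)\<close>. They depend on the next set of the tuple as well and are meaningful only for
  \<open>i < k\<close>.\<close>

primrec casc_coll ::
    "'a set \<Rightarrow> 'a set list \<Rightarrow> ('a set \<Rightarrow> ('a \<times> 'b) set) \<Rightarrow> nat \<Rightarrow> 'a set \<Rightarrow> ('a \<times> 'b) set" where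
  "casc_coll X ws H 0 = H"
| "casc_coll X ws H (Suc i) =
     (if casc_set X ws (Suc (Suc i)) \<subseteq> casc_set X ws (Suc i)
      then casc_coll X ws H i
      else compl_coll (casc_pre X ws (Suc i)) (casc_set X ws (Suc i)) (casc_coll X ws H i))"

primrec casc_map ::
    "'a set \<Rightarrow> 'a set list \<Rightarrow> ('a set \<Rightarrow> ('a \<times> 'b) set) \<Rightarrow> ('a \<Rightarrow> 'b set) \<Rightarrow> nat \<Rightarrow> 'a \<Rightarrow> 'b set" where
  "casc_map X ws H F 0 = F"
| "casc_map X ws H F (Suc i) =
     (let D = casc_pre X ws (Suc i); W = casc_set X ws (Suc i);
          H' = casc_coll X ws H i; F' = casc_map X ws H F i;
          F'' = sub_map D W H' F'
      in if casc_set X ws (Suc (Suc i)) \<subseteq> W then F''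
         else compl_map D W (Sigma W F'') F')"


subsection \<open>The generalized Hall condition\<close>

text \<open>In the next four definitions the parameter \<open>P\<close> stands for the generalized Hall condition on vertex
  sets smaller than \<open>X\<close>; \<open>P W G\<close> is about the mapping \<open>G\<close> on \<open>W\<close>.\<close>

definition critical_set ::
    "('a set \<Rightarrow> ('a \<Rightarrow> 'b set) \<Rightarrow> bool) \<Rightarrow> 'a set \<Rightarrow> ('a \<Rightarrow> 'b set) \<Rightarrow> 'a set \<Rightarrow> bool" where
  "critical_set P X F W \<longleftrightarrow> W \<noteq> {} \<and> W \<subseteq> X \<and>
     (\<exists>x\<in>X - W. \<exists>y\<in>Y. \<not> P W (compl_map X {x} {(x, y)} F))"

definition minimal_critical_set ::
    "('a set \<Rightarrow> ('a \<Rightarrow> 'b set) \<Rightarrow> bool) \<Rightarrow> 'a set \<Rightarrow> ('a \<Rightarrow> 'b set) \<Rightarrow> 'a set \<Rightarrow> bool" where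
  "minimal_critical_set P X F W \<longleftrightarrow>
     critical_set P X F W \<and> (\<forall>W'. W' \<subset> W \<longrightarrow> \<not> critical_set P X F W')"

definition primitive_critical_cascade ::
    "('a set \<Rightarrow> ('a \<Rightarrow> 'b set) \<Rightarrow> bool) \<Rightarrow> 'a set \<Rightarrow> ('a \<Rightarrow> 'b set) \<Rightarrow> ('a set \<Rightarrow> ('a \<times> 'b) set)
      \<Rightarrow> 'a set list \<Rightarrow> bool" where
  "primitive_critical_cascade P X F H ws \<longleftrightarrow> cascade X ws \<and>
     (\<forall>i\<in>{1..length ws}.
        minimal_critical_set P (casc_pre X ws i) (casc_map X ws H F (i - 1)) (casc_set X ws i))"

definition distributed_collection ::
    "('a set \<Rightarrow> ('a \<Rightarrow> 'b set) \<Rightarrow> bool) \<Rightarrow> 'a set \<Rightarrow> ('a \<Rightarrow> 'b set) \<Rightarrow> ('a set \<Rightarrow> ('a \<times> 'b) set)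
      \<Rightarrow> bool" where
  "distributed_collection P X F H \<longleftrightarrow>
     (\<forall>ws. primitive_critical_cascade P X F H ws \<longrightarrow>
        (\<forall>i\<in>{1..length ws}.
           set_distributed (casc_pre X ws i) (casc_set X ws i) (casc_coll X ws H (i - 1))))"

lemma critical_set_cong:
  assumes "\<And>W G. W \<subset> X \<Longrightarrow> P W G = Q W G" and "D \<subseteq> X"
  shows "critical_set P D F W = critical_set Q D F W"
proof -
  have "P W G = Q W G" if "x \<in> D - W" "W \<subseteq> D" for x G
    using that assms(2) by (intro assms(1)) blast
  then show ?thesis
    unfolding critical_set_def by blast
qed

lemma cascade_subsets:
  assumes "cascade X ws" and "i \<le> length ws"
  shows "casc_set X ws i \<subseteq> X" and "casc_co X ws i \<subseteq> X"
proof -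
  have *: "casc_set X ws j \<subseteq> X" if "j \<le> length ws" for j
    using assms(1) that by (cases j) (auto simp: cascade_def casc_set_def)
  then show "casc_set X ws i \<subseteq> X"
    using assms(2) .
  show "casc_co X ws i \<subseteq> X"
    using assms(2)
  proof (induction i)
    case (Suc i)
    then show ?case using *[of i] by auto
  qed simp
qed

lemma distributed_collection_cong [fundef_cong]:
  assumes "X = X'" "F = F'" "H = H'" and "\<And>W G. W \<subset> X' \<Longrightarrow> P W G = Q W G"
  shows "distributed_collection P X F H = distributed_collection Q X' F' H'"
proof -
  have "minimal_critical_set P (casc_pre X' ws i) G W = minimal_critical_set Q (casc_pre X' ws i) G W"
    if "cascade X' ws" "i \<in> {1..length ws}" for ws i G W
  proof -
    have "casc_pre X' ws i \<subseteq> X'"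
      using cascade_subsets[OF that(1), of "i - 1"] that(2) by (simp add: casc_pre_def le_diff_conv)
    then have "critical_set P (casc_pre X' ws i) G V = critical_set Q (casc_pre X' ws i) G V" for V
      using assms(4) by (intro critical_set_cong)
    then show ?thesis
      by (simp add: minimal_critical_set_def)
  qed
  then have "primitive_critical_cascade P X' F' H' ws = primitive_critical_cascade Q X' F' H' ws" for ws
    unfolding primitive_critical_cascade_def by auto
  then show ?thesis
    using assms(1-3) by (simp add: distributed_collection_def)
qed

text \<open>The value on sets that are empty or infinite is irrelevant.\<close>

function gen_hall :: "'a set \<Rightarrow> ('a \<Rightarrow> 'b set) \<Rightarrow> bool" where
  "gen_hall X F \<longleftrightarrow>
     (if card X = 1 then Sigma X F \<noteq> {}
      else if card X > 1 then \<exists>H. hall_collection X F H \<and> distributed_collection gen_hall X F H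
      else False)"
  by pat_completeness auto
termination
proof (relation "measure (\<lambda>(X, F). card X)")
  fix X W :: "'a set" and F G :: "'a \<Rightarrow> 'b set"
  assume "card X \<noteq> 1" "1 < card X" "W \<subset> X"
  then show "((W, G), (X, F)) \<in> measure (\<lambda>(X, F). card X)"
    by (auto intro!: psubset_card_mono card_ge_0_finite)
qed auto

declare gen_hall.simps [simp del]

end

end

theory Submission
  imports Defs
begin

text \<open>
  If \<open>s\<close> is a disparate selection, then the sets \<open>G(s\<^bsub>|V\<^esub>)\<close> form a Hall collection.  Since the points of
  \<open>G(s)\<close> are pairwise disparate, passing to \<open>\<H>\<^bsub>|W\<^esub>\<close> or to \<open>\<H>\<^sub>W\<close> along a cascade again yields the
  sets \<open>G(s\<^bsub>|V\<^esub>)\<close> on the smaller domain (\<open>casc_coll_graph_of\<close>), and such a family is \<open>W\<close>-distributed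
  because, for \<open>V\<close> disjoint from \<open>W\<close>, the set \<open>G(s\<^bsub>|V\<^esub>)\<close> does not meet the hull of \<open>G(s\<^bsub>|W\<^esub>)\<close>
  (\<open>set_distributed_graph_of\<close>).  So the collection is distributed, whatever the critical sets are.

  The converse is by induction on \<open>card X\<close>, the case of one vertex being trivial.  If there is no
  generalized critical set, take any point \<open>(x, y)\<close> of the graph of \<open>F\<close>: as \<open>X - {x}\<close> is not
  critical, the points of \<open>F\<close> over \<open>X - {x}\<close> that are disparate from \<open>(x, y)\<close> satisfy the condition, hence
  contain a disparate selection, which \<open>(x, y)\<close> completes.  Otherwise, choose a minimal generalized critical set \<open>W\<close> and a distributed Hall
  collection \<open>\<H>\<close>.  Being \<open>W\<close>-distributed, \<open>\<H>\<close> loses at most \<open>card W\<close> points of each \<open>A\<^bsub>W \<union> V\<^esub>\<close> in the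
  passage to \<open>\<H>\<^sub>W\<close>, so \<open>\<H>\<^sub>W\<close> is a Hall collection (\<open>hall_collection_compl\<close>).  With \<open>F''\<close> the submapping
  of \<open>F\<^bsub>|W\<^esub>\<close> determined by \<open>\<H>\<^sub>W\<close>, the collections \<open>\<H>\<^bsub>|W\<^esub>\<close> of \<open>F''\<close> and \<open>\<H>\<^sub>W\<close> of \<open>F\<^bsub>W,G(F'')\<^esub>\<close> are
  distributed, because prefixing \<open>W\<close> to a primitive critical cascade of either gives one of \<open>(F, \<H>)\<close>
  (\<open>distributed_collection_tail\<close>).  By induction both mappings have disparate selections, and these are
  disparate from each other by construction.

  The induction passes to smaller vertex sets while keeping \<open>E\<close>, so the lemmas are stated for an
  arbitrary \<open>E\<close>, whose members need not lie in the vertex set at hand.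
\<close>

section \<open>Disparate points and selections\<close>

lemma disparate_commute: "disparate E a b \<longleftrightarrow> disparate E b a"
  by (auto simp: disparate_def insert_commute)

text \<open>The graph of a single-valued mapping on \<open>V\<close>.\<close>

definition graph_of :: "('a \<Rightarrow> 'b) \<Rightarrow> 'a set \<Rightarrow> ('a \<times> 'b) set" where
  "graph_of s V = (\<lambda>x. (x, s x)) ` V"

lemma mem_graph_of [simp]: "(x, y) \<in> graph_of s V \<longleftrightarrow> x \<in> V \<and> y = s x"
  by (auto simp: graph_of_def)

lemma card_graph_of: "card (graph_of s V) = card V"
  unfolding graph_of_def by (intro card_image inj_onI) simp

lemma graph_of_mono: "V \<subseteq> W \<Longrightarrow> graph_of s V \<subseteq> graph_of s W"
  by (auto simp: graph_of_def)

lemma disparate_selection_graph_of: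
  "disparate_selection E X F s \<longleftrightarrow> (\<forall>x\<in>X. s x \<in> F x) \<and> disparate_set E (graph_of s X)"
  by (simp add: disparate_selection_def selection_def graph_of_def)

lemma disparate_graph_of:
  assumes "disparate_set E (graph_of s X)" "x \<in> X" "x' \<in> X" "x \<noteq> x'"
  shows "disparate E (x, s x) (x', s x')"
proof -
  have "(x, s x) \<in> graph_of s X" "(x', s x') \<in> graph_of s X" "(x, s x) \<noteq> (x', s x')"
    using assms by simp_all
  then show ?thesis
    using assms(1) unfolding disparate_set_def by blast
qed

lemma disparate_selection_Un:
  assumes s: "disparate_selection E W F s" and t: "disparate_selection E V G t"
    and disj: "W \<inter> V = {}"
    and F: "\<And>x. x \<in> W \<Longrightarrow> F x \<subseteq> K x" and G: "\<And>x. x \<in> V \<Longrightarrow> G x \<subseteq> K x"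
    and FG: "\<And>x y x' y'. x \<in> W \<Longrightarrow> y \<in> F x \<Longrightarrow> x' \<in> V \<Longrightarrow> y' \<in> G x' \<Longrightarrow> disparate E (x, y) (x', y')"
  shows "\<exists>u. disparate_selection E (W \<union> V) K u"
proof -
  define u where "u = (\<lambda>x. if x \<in> W then s x else t x)"
  have sF: "\<And>x. x \<in> W \<Longrightarrow> s x \<in> F x" and tG: "\<And>x. x \<in> V \<Longrightarrow> t x \<in> G x"
    and ds: "disparate_set E (graph_of s W)" and dt: "disparate_set E (graph_of t V)"
    using s t by (auto simp: disparate_selection_graph_of)
  have uW: "u x = s x" if "x \<in> W" for x
    using that by (simp add: u_def)
  have uV: "u x = t x" if "x \<in> V" for x
    using that disj by (auto simp: u_def)
  have "disparate E (x, u x) (x', u x')" if xx: "x \<in> W \<union> V" "x' \<in> W \<union> V" "x \<noteq> x'" for x x'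
  proof -
    consider "x \<in> W" "x' \<in> W" | "x \<in> V" "x' \<in> V" | "x \<in> W" "x' \<in> V" | "x \<in> V" "x' \<in> W"
      using xx by blast
    then show ?thesis
    proof cases
      case 1
      then show ?thesis using disparate_graph_of[OF ds] xx by (simp add: uW)
    next
      case 2
      then show ?thesis using disparate_graph_of[OF dt] xx by (simp add: uV)
    next
      case 3
      then show ?thesis using FG sF tG by (simp add: uW uV)
    next
      case 4
      then have "disparate E (x', u x') (x, u x)" using FG sF tG by (simp add: uW uV)
      then show ?thesis by (simp only: disparate_commute)
    qed
  qed
  then have "disparate_set E (graph_of u (W \<union> V))"
    by (force simp: disparate_set_def)
  moreover have "\<forall>x\<in>W \<union> V. u x \<in> K x"
    using sF tG F G uW uV by (metis UnE subsetD)
  ultimately show ?thesis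
    by (auto simp: disparate_selection_graph_of)
qed

lemma disparate_selection_insert:
  assumes "y \<in> F x"
    and t: "disparate_selection E (X - {x}) (compl_map E Y X {x} {(x, y)} F) t" and "x \<in> X"
  shows "\<exists>s. disparate_selection E X F s"
proof -
  have "disparate_selection E {x} (\<lambda>_. {y}) (\<lambda>_. y)"
    by (simp add: disparate_selection_graph_of disparate_set_def graph_of_def)
  then have "\<exists>s. disparate_selection E ({x} \<union> (X - {x})) F s"
    using t
  proof (rule disparate_selection_Un)
    show "disparate E (z, w) (z', w')" if "z \<in> {x}" "w \<in> {y}"
      "z' \<in> X - {x}" "w' \<in> compl_map E Y X {x} {(x, y)} F z'" for z w z' w'
      using that by (auto simp: compl_map_def disp_compl_def disparate_commute[of E "(x, y)"])
  qed (use assms(1) in \<open>auto simp: compl_map_def\<close>)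
  then show ?thesis
    using assms(3) by (simp add: insert_absorb)
qed

lemma disparate_selection_sub_compl:
  assumes s: "disparate_selection E W (sub_map E Y X W H F) s"
    and t: "disparate_selection E (X - W) (compl_map E Y X W (Sigma W (sub_map E Y X W H F)) F) t"
    and "W \<subseteq> X"
  shows "\<exists>u. disparate_selection E X F u"
proof -
  have "\<exists>u. disparate_selection E (W \<union> (X - W)) F u"
    using s t
  proof (rule disparate_selection_Un)
    show "disparate E (x, y) (x', y')" if "x \<in> W" "y \<in> sub_map E Y X W H F x" "x' \<in> X - W"
      "y' \<in> compl_map E Y X W (Sigma W (sub_map E Y X W H F)) F x'" for x y x' y'
    proof -
      have "(x, y) \<in> Sigma W (sub_map E Y X W H F)"
        using that by blast
      moreover have "(x', y') \<in> disp_compl E Y X (Sigma W (sub_map E Y X W H F))"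
        using that(4) by (simp add: compl_map_def)
      ultimately show ?thesis
        by (subst disparate_commute) (auto simp: disp_compl_def)
    qed
  qed (auto simp: sub_map_def compl_map_def)
  then show ?thesis
    using assms(3) by (simp add: Un_absorb1)
qed

section \<open>The collection of a disparate selection\<close>

lemma coll_Union_graph_of:
  assumes "\<And>V. V \<noteq> {} \<Longrightarrow> V \<subseteq> W \<Longrightarrow> H V = graph_of s V"
  shows "coll_Union W H = graph_of s W"
proof -
  have "coll_Union W H = (\<Union>V \<in> {V. V \<noteq> {} \<and> V \<subseteq> W}. graph_of s V)"
    unfolding coll_Union_def using assms by (intro SUP_cong) auto
  also have "\<dots> = graph_of s W"
    by (auto simp: graph_of_def)
  finally show ?thesis .
qed

text \<open>One step of a cascade: \<open>D\<close> is the current domain, and the current collection \<open>H\<close> consists of the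
  graphs of \<open>s\<close>.\<close>

context
  fixes E :: "'a set set" and Y :: "'b set" and X D W :: "'a set" and s :: "'a \<Rightarrow> 'b"
    and H :: "'a set \<Rightarrow> ('a \<times> 'b) set"
  assumes disp: "disparate_set E (graph_of s X)" and sY: "\<And>x. x \<in> X \<Longrightarrow> s x \<in> Y"
    and D: "D \<subseteq> X" and W: "W \<subseteq> D" and H: "\<And>V. V \<noteq> {} \<Longrightarrow> V \<subseteq> D \<Longrightarrow> H V = graph_of s V"
begin

lemma compl_coll_graph_of:
  assumes "V \<noteq> {}" "V \<subseteq> D - W"
  shows "compl_coll E Y D W H V = graph_of s V"
proof -
  have "H (W \<union> V) = graph_of s (W \<union> V)"
    using assms W by (intro H) auto
  moreover have "coll_Union W H = graph_of s W"
    using W by (intro coll_Union_graph_of H) auto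
  moreover have "disparate E (x, s x) (x', s x')" if "x \<in> V" "x' \<in> W" for x x'
    using disparate_graph_of[OF disp, of x x'] that assms W D by blast
  moreover have "s x \<in> Y" if "x \<in> V" for x
    using that assms D by (intro sY) blast
  ultimately show ?thesis
    unfolding compl_coll_def disp_compl_def using assms D by auto
qed

lemma set_distributed_graph_of: "set_distributed E Y D W H"
  unfolding set_distributed_def
proof (intro allI impI)
  fix V assume V: "V \<noteq> {} \<and> V \<subseteq> D - W"
  have "H (W \<union> V) = graph_of s (W \<union> V)"
    using V W by (intro H) auto
  moreover have "coll_Union W H = graph_of s W"
    using W by (intro coll_Union_graph_of H) auto
  moreover have "disparate E (x, s x) (x', s x')" if "x \<in> V" "x' \<in> W" for x x'
    using disparate_graph_of[OF disp, of x x'] that V W D by blast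
  moreover have "s x \<in> Y" if "x \<in> W" for x
    using that W D by (intro sY) blast
  ultimately have "H (W \<union> V) \<inter> (W \<times> Y \<union> (disp_hull E Y D (coll_Union W H) \<inter> V \<times> Y)) = graph_of s W"
    unfolding disp_hull_def using V by auto
  then show "card (H (W \<union> V) \<inter> (W \<times> Y \<union> (disp_hull E Y D (coll_Union W H) \<inter> V \<times> Y))) \<le> card W"
    by (simp add: card_graph_of)
qed

end

section \<open>Cascades\<close>

lemma casc_co_Suc: "casc_co X ws (Suc i) = casc_pre X ws (Suc i) - casc_set X ws (Suc i)"
  by (simp add: casc_pre_def)

lemma casc_set_subset_pre:
  assumes "cascade X ws" "i \<in> {1..length ws}"
  shows "casc_set X ws i \<subseteq> casc_pre X ws i"
  using assms by (auto simp: cascade_def casc_pre_def)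

lemma casc_pre_subset:
  assumes "cascade X ws" "i \<in> {1..length ws}"
  shows "casc_pre X ws i \<subseteq> X"
  using cascade_subsets[OF assms(1), of "i - 1"] assms(2) by (simp add: casc_pre_def le_diff_conv)

lemma casc_coll_graph_of:
  assumes disp: "disparate_set E (graph_of s X)" and sY: "\<And>x. x \<in> X \<Longrightarrow> s x \<in> Y"
    and ws: "cascade X ws" and "i < length ws" and "V \<noteq> {}" and "V \<subseteq> casc_pre X ws (Suc i)"
  shows "casc_coll E Y X ws (graph_of s) i V = graph_of s V"
  using assms(4-)
proof (induction i arbitrary: V)
  case 0
  then show ?case by simp
next
  case (Suc i)
  let ?W = "casc_set X ws (Suc i)" and ?D = "casc_pre X ws (Suc i)"
  have WD: "?W \<subseteq> ?D" and DX: "?D \<subseteq> X"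
    using casc_set_subset_pre[OF ws, of "Suc i"] casc_pre_subset[OF ws, of "Suc i"] Suc.prems by auto
  show ?case
  proof (cases "casc_set X ws (Suc (Suc i)) \<subseteq> ?W")
    case True
    then have "V \<subseteq> ?D"
      using Suc.prems WD by (auto simp: casc_pre_def)
    then show ?thesis
      using Suc True by simp
  next
    case False
    then have "V \<subseteq> ?D - ?W"
      using Suc.prems casc_co_Suc[of X ws i] by (simp add: casc_pre_def[of X ws "Suc (Suc i)"])
    then show ?thesis
      using False Suc compl_coll_graph_of[OF disp sY DX WD] by simp
  qed
qed

text \<open>Prefixing \<open>W\<close> to a tuple in \<open>Z\<close>, where \<open>Z\<close> is \<open>W\<close> or its complement, shifts all notions of
  cascades by one.  The hypothesis \<open>first\<close> says that the first set of the tuple selects the half \<open>Z\<close>.\<close>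

context
  fixes X W Z :: "'a set" and ws :: "'a set list"
  assumes ws: "cascade Z ws" and W: "W \<subseteq> X"
    and first: "Z = (if hd ws \<subseteq> W then W else X - W)"
begin

lemma Z_subset: "Z \<subseteq> X"
  using first W by (auto split: if_splits)

lemma casc_set_1: "casc_set X (W # ws) (Suc 0) = W"
  by (simp add: casc_set_def)

lemma casc_pre_1: "casc_pre X (W # ws) (Suc 0) = X"
  using W by (auto simp: casc_pre_def casc_set_def)

lemma casc_set_shift: "casc_set X (W # ws) (Suc (Suc i)) = casc_set Z ws (Suc i)"
  by (simp add: casc_set_def)

lemma hd_conv_casc_set: "casc_set Z ws (Suc 0) = hd ws"
  using ws by (simp add: casc_set_def cascade_def hd_conv_nth)

lemma hd_subset: "hd ws \<subseteq> Z"
  using ws by (simp add: cascade_def)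

lemma casc_pre_shift_1: "casc_pre X (W # ws) (Suc (Suc 0)) = casc_pre Z ws (Suc 0)"
proof -
  have "casc_pre Z ws (Suc 0) = Z"
    by (simp add: casc_pre_def casc_set_def[of Z ws 0])
  then show ?thesis
    using W casc_set_shift[of 0] hd_conv_casc_set first
    by (auto simp: casc_pre_def[of X] casc_set_1 casc_pre_def[of Z] casc_set_def[of X _ 0]
        casc_set_def[of Z _ 0])
qed

lemma casc_co_shift: "casc_co X (W # ws) (Suc (Suc i)) = casc_co Z ws (Suc i)"
proof (induction i)
  case 0
  show ?case
    by (simp only: casc_co_Suc casc_pre_shift_1 casc_set_shift)
next
  case (Suc i)
  show ?case
    by (simp only: casc_co.simps(2)[where i = "Suc (Suc i)"] casc_co.simps(2)[where i = "Suc i" and ws = ws]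
        casc_set_shift Suc)
qed

lemma casc_pre_shift: "casc_pre X (W # ws) (Suc (Suc i)) = casc_pre Z ws (Suc i)"
proof (cases i)
  case (Suc j)
  show ?thesis
    by (simp only: casc_pre_def casc_set_shift casc_co_shift diff_Suc_1 Suc)
qed (simp only: casc_pre_shift_1)

lemma cascade_Cons: "cascade X (W # ws)"
  unfolding cascade_def
proof (intro conjI ballI)
  show "W' \<subseteq> X" if "W' \<in> set (W # ws)" for W'
    using that ws W Z_subset by (auto simp: cascade_def)
  fix i assume i: "i \<in> {1..length (W # ws)}"
  consider "i = Suc 0" | j where "i = Suc (Suc j)" "Suc j \<in> {1..length ws}"
    using i by (cases i; cases "i - 1") auto
  then show "casc_set X (W # ws) i \<subseteq> casc_set X (W # ws) (i - 1)
      \<or> casc_set X (W # ws) i \<subseteq> casc_co X (W # ws) (i - 1)"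
  proof cases
    case 1
    then show ?thesis using W by (simp add: casc_set_def)
  next
    case (2 j)
    then have "casc_set X (W # ws) i \<subseteq> casc_pre X (W # ws) i"
      using casc_set_subset_pre[OF ws] by (simp only: casc_set_shift casc_pre_shift)
    then show ?thesis
      by (auto simp only: casc_pre_def split: if_splits)
  qed
qed simp

text \<open>\<open>G\<close> and \<open>K\<close> are the mapping and the collection on \<open>Z\<close> that the step at \<open>W\<close> produces from
  \<open>F\<close> and \<open>H\<close>.\<close>

context
  fixes E :: "'a set set" and Y :: "'b set" and F G :: "'a \<Rightarrow> 'b set"
    and H K :: "'a set \<Rightarrow> ('a \<times> 'b) set"
  assumes K: "K = (if hd ws \<subseteq> W then H else compl_coll E Y X W H)"
    and G: "G = (if hd ws \<subseteq> W then sub_map E Y X W H F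
                 else compl_map E Y X W (Sigma W (sub_map E Y X W H F)) F)"
begin

lemma casc_coll_shift: "casc_coll E Y X (W # ws) H (Suc i) = casc_coll E Y Z ws K i"
proof (induction i)
  case 0
  then show ?case
    using casc_set_shift[of 0] hd_conv_casc_set K
    by (simp add: casc_pre_1 casc_set_1)
next
  case (Suc i)
  show ?case
    by (simp only: casc_coll.simps(2)[where i = "Suc i"] casc_coll.simps(2)[where i = i and ws = ws]
        Suc casc_set_shift casc_pre_shift)
qed

lemma casc_map_shift: "casc_map E Y X (W # ws) H F (Suc i) = casc_map E Y Z ws K G i"
proof (induction i)
  case 0
  then show ?case
    using casc_set_shift[of 0] hd_conv_casc_set G
    by (simp add: casc_pre_1 casc_set_1 Let_def)
next
  case (Suc i)
  show ?case
    by (simp only: casc_map.simps(2)[where i = "Suc i"] casc_map.simps(2)[where i = i and ws = ws]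
        Suc casc_coll_shift casc_set_shift casc_pre_shift)
qed

lemma primitive_critical_cascade_Cons:
  assumes min: "minimal_critical_set E Y P X F W"
    and prim: "primitive_critical_cascade E Y P Z G K ws"
  shows "primitive_critical_cascade E Y P X F H (W # ws)"
  unfolding primitive_critical_cascade_def
proof (intro conjI ballI)
  fix i assume i: "i \<in> {1..length (W # ws)}"
  consider "i = Suc 0" | j where "i = Suc (Suc j)" "Suc j \<in> {1..length ws}"
    using i by (cases i; cases "i - 1") auto
  then show "minimal_critical_set E Y P (casc_pre X (W # ws) i) (casc_map E Y X (W # ws) H F (i - 1))
      (casc_set X (W # ws) i)"
  proof cases
    case 1
    then show ?thesis using min by (simp add: casc_pre_1 casc_set_1)
  next
    case (2 j)
    then have "minimal_critical_set E Y P (casc_pre Z ws (Suc j)) (casc_map E Y Z ws K G j)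
        (casc_set Z ws (Suc j))"
      using prim unfolding primitive_critical_cascade_def by (metis diff_Suc_1)
    then show ?thesis
      using 2 by (simp only: casc_map_shift casc_set_shift casc_pre_shift diff_Suc_1)
  qed
qed (rule cascade_Cons)

end

end

text \<open>Both halves of the splitting at a minimal critical set inherit a distributed collection.\<close>

lemma distributed_collection_tail:
  assumes dist: "distributed_collection E Y P X F H"
    and min: "minimal_critical_set E Y P X F W"
    and choice: "Z = W \<and> K = H \<and> G = sub_map E Y X W H F \<or>
      Z = X - W \<and> K = compl_coll E Y X W H \<and>
        G = compl_map E Y X W (Sigma W (sub_map E Y X W H F)) F"
  shows "distributed_collection E Y P Z G K"
  unfolding distributed_collection_def
proof (intro allI impI ballI)
  fix ws i
  assume prim: "primitive_critical_cascade E Y P Z G K ws" and i: "i \<in> {1..length ws}"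
  have W: "W \<subseteq> X"
    using min by (simp add: minimal_critical_set_def critical_set_def)
  have ws: "cascade Z ws" and "ws \<noteq> []"
    using prim by (auto simp: primitive_critical_cascade_def cascade_def)
  have "minimal_critical_set E Y P (casc_pre Z ws 1) (casc_map E Y Z ws K G 0) (casc_set Z ws 1)"
    using prim \<open>ws \<noteq> []\<close> by (force simp: primitive_critical_cascade_def Suc_le_eq)
  \<comment> \<open>Critical sets are nonempty, so the first set of the tuple lies in only one of \<open>W\<close> and \<open>X - W\<close>.\<close>
  then have "hd ws \<noteq> {}"
    using hd_conv_nth[OF \<open>ws \<noteq> []\<close>]
    by (simp add: minimal_critical_set_def critical_set_def casc_set_def)
  moreover have "hd ws \<subseteq> Z"
    using ws by (simp add: cascade_def)
  ultimately have first: "Z = (if hd ws \<subseteq> W then W else X - W)"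
    and K: "K = (if hd ws \<subseteq> W then H else compl_coll E Y X W H)"
    and G: "G = (if hd ws \<subseteq> W then sub_map E Y X W H F
                 else compl_map E Y X W (Sigma W (sub_map E Y X W H F)) F)"
    using choice by auto
  have "primitive_critical_cascade E Y P X F H (W # ws)"
    by (rule primitive_critical_cascade_Cons[OF ws W first K G min prim])
  then have "set_distributed E Y (casc_pre X (W # ws) (Suc i)) (casc_set X (W # ws) (Suc i))
      (casc_coll E Y X (W # ws) H i)"
    using dist i by (force simp: distributed_collection_def)
  moreover obtain k where "i = Suc k"
    using i by (cases i) auto
  ultimately show "set_distributed E Y (casc_pre Z ws i) (casc_set Z ws i) (casc_coll E Y Z ws K (i - 1))"
    using casc_set_shift[OF ws W first, of k] casc_pre_shift[OF ws W first, of k]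
      casc_coll_shift[OF ws W first K G, of k] by simp
qed

section \<open>Splitting a Hall collection at a set for which it is distributed\<close>

context
  fixes E :: "'a set set" and Y :: "'b set" and X W :: "'a set" and F :: "'a \<Rightarrow> 'b set"
    and H :: "'a set \<Rightarrow> ('a \<times> 'b) set"
  assumes fin: "finite X" "finite Y" and FY: "\<And>x. x \<in> X \<Longrightarrow> F x \<subseteq> Y"
    and hall: "hall_collection E X F H" and W: "W \<subseteq> X"
begin

lemma hall_collectionD:
  assumes "V \<noteq> {}" "V \<subseteq> X"
  shows "H V \<subseteq> Sigma V F" "disparate_set E (H V)" "card V \<le> card (H V)" "H V \<subseteq> V \<times> Y"
proof -
  show "H V \<subseteq> Sigma V F" "disparate_set E (H V)" "card V \<le> card (H V)"
    using assms hall by (auto simp: hall_collection_def collection_def)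
  then show "H V \<subseteq> V \<times> Y"
    using FY assms by blast
qed

text \<open>The points of \<open>F\<close> over \<open>W\<close> kept in the submapping are disparate from \<open>\<H>\<^sub>W\<close> by definition,
  and the points of \<open>\<H>\<^bsub>|W\<^esub>\<close> are among them by the definition of \<open>\<H>\<^sub>W\<close>.\<close>

lemma hall_collection_sub:
  "hall_collection E W (sub_map E Y X W H F) H"
  unfolding hall_collection_def collection_def
proof (intro conjI allI impI)
  fix V assume V: "V \<noteq> {} \<and> V \<subseteq> W"
  then have VX: "V \<noteq> {}" "V \<subseteq> X"
    using W by auto
  show "disparate_set E (H V)" "card V \<le> card (H V)"
    using hall_collectionD[OF VX] by auto
  show "H V \<subseteq> Sigma V (sub_map E Y X W H F)"
  proof
    fix p assume p: "p \<in> H V"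
    obtain x y where xy: "p = (x, y)" by fastforce
    have F: "x \<in> V" "y \<in> F x" "y \<in> Y"
      using p xy hall_collectionD(1,4)[OF VX] by auto
    have "p \<in> coll_Union W H"
      using p V by (auto simp: coll_Union_def)
    then have "disparate E p q" if "q \<in> coll_Union (X - W) (compl_coll E Y X W H)" for q
      using that disparate_commute[of E p q]
      by (auto simp: coll_Union_def[of "X - W"] compl_coll_def disp_compl_def)
    then show "p \<in> Sigma V (sub_map E Y X W H F)"
      using F V VX xy by (auto simp: sub_map_def disp_compl_def)
  qed
qed

text \<open>Every point of \<open>A\<^bsub>W \<union> V\<^esub>\<close> outside \<open>\<H>\<^sub>W\<close> belongs to the set bounded in the definition of a
  \<open>W\<close>-distributed collection, so at least \<open>card (W \<union> V) - card W = card V\<close> points are left.\<close>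

lemma hall_collection_compl:
  assumes dist: "set_distributed E Y X W H"
  shows "hall_collection E (X - W) (compl_map E Y X W (Sigma W (sub_map E Y X W H F)) F)
    (compl_coll E Y X W H)"
  unfolding hall_collection_def collection_def
proof (intro conjI allI impI)
  fix V assume V: "V \<noteq> {} \<and> V \<subseteq> X - W"
  then have WV: "W \<union> V \<noteq> {}" "W \<union> V \<subseteq> X"
    using W by auto
  note A = hall_collectionD[OF WV]
  let ?B = "H (W \<union> V) \<inter> (W \<times> Y \<union> (disp_hull E Y X (coll_Union W H) \<inter> V \<times> Y))"
  have fin': "finite W" "finite V" "finite (H (W \<union> V))"
    using fin WV finite_subset[OF A(4)] by (auto intro: finite_subset)
  show "disparate_set E (compl_coll E Y X W H V)"
    using A(2) by (auto simp: compl_coll_def disparate_set_def)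
  show "card V \<le> card (compl_coll E Y X W H V)"
  proof -
    have "H (W \<union> V) \<subseteq> ?B \<union> compl_coll E Y X W H V"
      using A(4) V by (auto simp: compl_coll_def disp_hull_def disp_compl_def)
    then have "card (H (W \<union> V)) \<le> card (?B \<union> compl_coll E Y X W H V)"
      using fin' by (intro card_mono) (auto simp: compl_coll_def)
    also have "\<dots> \<le> card ?B + card (compl_coll E Y X W H V)"
      by (rule card_Un_le)
    also have "card ?B \<le> card W"
      using dist V by (simp add: set_distributed_def)
    finally have "card (W \<union> V) \<le> card W + card (compl_coll E Y X W H V)"
      using A(3) by linarith
    moreover have "card (W \<union> V) = card W + card V"
      using fin' V by (intro card_Un_disjoint) auto
    ultimately show ?thesis by linarith
  qed
  show "compl_coll E Y X W H V \<subseteq> Sigma V (compl_map E Y X W (Sigma W (sub_map E Y X W H F)) F)"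
  proof
    fix p assume p: "p \<in> compl_coll E Y X W H V"
    obtain x y where xy: "p = (x, y)" by fastforce
    have F: "x \<in> V" "y \<in> F x" "y \<in> Y"
      using p xy A(1) by (auto simp: compl_coll_def)
    have "p \<in> coll_Union (X - W) (compl_coll E Y X W H)"
      using p V by (auto simp: coll_Union_def[of "X - W"])
    then have "disparate E p q" if "q \<in> Sigma W (sub_map E Y X W H F)" for q
      using that disparate_commute[of E p q] by (auto simp: sub_map_def disp_compl_def)
    then show "p \<in> Sigma V (compl_map E Y X W (Sigma W (sub_map E Y X W H F)) F)"
      using F V xy by (auto simp: compl_map_def disp_compl_def)
  qed
qed

end

section \<open>The equivalence\<close>

text \<open>On a single vertex \<open>x\<close>, where the condition is not stated by collections, the set \<open>A\<^bsub>{x}\<^esub>\<close> of a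
  Hall collection is a nonempty subset of the graph.\<close>

lemma gen_hall_intro:
  assumes "finite X" "X \<noteq> {}" "hall_collection E X F H" "distributed_collection E Y (gen_hall E Y) X F H"
  shows "gen_hall E Y X F"
proof (cases "card X = 1")
  case True
  have "H X \<subseteq> Sigma X F" "1 \<le> card (H X)"
    using assms(2,3) True by (auto simp: hall_collection_def collection_def)
  then have "Sigma X F \<noteq> {}"
    by auto
  then show ?thesis
    using True by (simp add: gen_hall.simps)
next
  case False
  moreover have "card X \<noteq> 0"
    using assms by simp
  ultimately show ?thesis
    using assms(3,4) by (subst gen_hall.simps) auto
qed

lemma gen_hall_if_disparate_selection:
  assumes "finite X" "X \<noteq> {}" and FY: "\<forall>x\<in>X. F x \<subseteq> Y" and s: "disparate_selection E X F s"
  shows "gen_hall E Y X F"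
proof (rule gen_hall_intro[OF assms(1,2)])
  have sF: "\<And>x. x \<in> X \<Longrightarrow> s x \<in> F x" and disp: "disparate_set E (graph_of s X)"
    using s by (auto simp: disparate_selection_graph_of)
  have sY: "\<And>x. x \<in> X \<Longrightarrow> s x \<in> Y"
    using sF FY by blast
  show "hall_collection E X F (graph_of s)"
    unfolding hall_collection_def collection_def
  proof (intro conjI allI impI)
    fix V assume V: "V \<noteq> {} \<and> V \<subseteq> X"
    show "graph_of s V \<subseteq> Sigma V F"
      using V sF by auto
    show "disparate_set E (graph_of s V)"
      using V disp graph_of_mono[of V X s] unfolding disparate_set_def by blast
  qed (simp add: card_graph_of)
  show "distributed_collection E Y (gen_hall E Y) X F (graph_of s)"
    unfolding distributed_collection_def
  proof (intro allI impI ballI)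
    fix ws i
    assume "primitive_critical_cascade E Y (gen_hall E Y) X F (graph_of s) ws"
      and i: "i \<in> {1..length ws}"
    then have ws: "cascade X ws"
      by (simp add: primitive_critical_cascade_def)
    show "set_distributed E Y (casc_pre X ws i) (casc_set X ws i) (casc_coll E Y X ws (graph_of s) (i - 1))"
    proof (rule set_distributed_graph_of[OF disp sY casc_pre_subset[OF ws i] casc_set_subset_pre[OF ws i]])
      fix V assume "V \<noteq> {}" "V \<subseteq> casc_pre X ws i"
      then show "casc_coll E Y X ws (graph_of s) (i - 1) V = graph_of s V"
        using i by (intro casc_coll_graph_of[OF disp sY ws]) auto
    qed
  qed
qed

lemma disparate_selection_if_gen_hall:
  assumes "finite X" "X \<noteq> {}" "finite Y" "\<forall>x\<in>X. F x \<subseteq> Y" "gen_hall E Y X F"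
  shows "\<exists>s. disparate_selection E X F s"
  using assms(1,2,4,5)
proof (induction "card X" arbitrary: X F rule: less_induct)
  case less
  note IH = less.hyps
  show ?case
  proof (cases "card X = 1")
    case True
    then obtain x where x: "X = {x}"
      by (auto simp: card_1_singleton_iff)
    have "Sigma X F \<noteq> {}"
      using less.prems(4) True by (simp add: gen_hall.simps)
    then obtain y where "y \<in> F x"
      using x by auto
    then have "disparate_selection E X F (\<lambda>_. y)"
      using x by (simp add: disparate_selection_graph_of disparate_set_def graph_of_def)
    then show ?thesis by blast
  next
    case False
    then obtain H where hall: "hall_collection E X F H"
      and dist: "distributed_collection E Y (gen_hall E Y) X F H"
      using less.prems(4) by (subst (asm) gen_hall.simps) (auto split: if_splits)
    let ?crit = "critical_set E Y (gen_hall E Y) X F"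
    show ?thesis
    proof (cases "\<exists>W. ?crit W")
      case no_crit: False
      have "H X \<subseteq> Sigma X F" "card X \<le> card (H X)"
        using hall less.prems(2) by (auto simp: hall_collection_def collection_def)
      moreover have "card X \<noteq> 0"
        using less.prems by simp
      ultimately have "Sigma X F \<noteq> {}"
        by auto
      then obtain x y where xy: "x \<in> X" "y \<in> F x"
        by blast
      have ne: "X - {x} \<noteq> {}"
        using False xy(1) by (auto simp: card_1_singleton_iff)
      have "\<not> ?crit (X - {x})"
        using no_crit by blast
      then have "gen_hall E Y (X - {x}) (compl_map E Y X {x} {(x, y)} F)"
        using ne xy less.prems(3) by (auto simp: critical_set_def)
      then have "\<exists>t. disparate_selection E (X - {x}) (compl_map E Y X {x} {(x, y)} F) t"
      proof (rule IH[rotated -1])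
        show "card (X - {x}) < card X"
          using less.prems(1) xy(1) by (rule card_Diff1_less)
        show "\<forall>z\<in>X - {x}. compl_map E Y X {x} {(x, y)} F z \<subseteq> Y"
          using less.prems(3) by (auto simp: compl_map_def)
      qed (use less.prems(1) ne in auto)
      then obtain t where t: "disparate_selection E (X - {x}) (compl_map E Y X {x} {(x, y)} F) t" ..
      show ?thesis
        using xy(2) t xy(1) by (rule disparate_selection_insert)
    next
      case True
      have "finite {W. ?crit W}"
        using less.prems(1) by (auto simp: critical_set_def intro: finite_subset[of _ "Pow X"])
      then obtain W where min: "minimal_critical_set E Y (gen_hall E Y) X F W"
        using finite_has_minimal[of "{W. ?crit W}"] True
        by (auto simp: minimal_critical_set_def)
      then have W: "W \<noteq> {}" "W \<subseteq> X" "X - W \<noteq> {}"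
        by (auto simp: minimal_critical_set_def critical_set_def)
      let ?F = "sub_map E Y X W H F"
      let ?G = "compl_map E Y X W (Sigma W ?F) F"
      let ?K = "compl_coll E Y X W H"
      have "primitive_critical_cascade E Y (gen_hall E Y) X F H [W]"
        using min W by (simp add: primitive_critical_cascade_def cascade_def casc_set_def casc_pre_def)
      then have distW: "set_distributed E Y X W H"
        using dist W by (force simp: distributed_collection_def casc_set_def casc_pre_def)
      have fin': "finite W" "finite (X - W)"
        using less.prems(1) W by (auto intro: finite_subset)
      have card: "card W < card X" "card (X - W) < card X"
        using W less.prems(1) by (auto intro!: psubset_card_mono)
      have FY: "\<And>x. x \<in> X \<Longrightarrow> F x \<subseteq> Y"
        using less.prems(3) by blast
      have "gen_hall E Y W ?F"
      proof (rule gen_hall_intro)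
        show "hall_collection E W ?F H"
          using less.prems(1) assms(3) FY hall W(2) by (rule hall_collection_sub)
        show "distributed_collection E Y (gen_hall E Y) W ?F H"
          by (rule distributed_collection_tail[OF dist min]) simp
      qed (use fin' W in auto)
      moreover have "\<forall>x\<in>W. ?F x \<subseteq> Y"
        by (auto simp: sub_map_def disp_compl_def)
      ultimately obtain s where s: "disparate_selection E W ?F s"
        using IH[OF card(1) fin'(1) W(1)] by blast
      have "gen_hall E Y (X - W) ?G"
      proof (rule gen_hall_intro)
        show "hall_collection E (X - W) ?G ?K"
          using less.prems(1) assms(3) FY hall W(2) distW by (rule hall_collection_compl)
        show "distributed_collection E Y (gen_hall E Y) (X - W) ?G ?K"
          by (rule distributed_collection_tail[OF dist min]) simp
      qed (use fin' W in auto)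
      moreover have "\<forall>x\<in>X - W. ?G x \<subseteq> Y"
        by (auto simp: compl_map_def disp_compl_def)
      ultimately obtain t where t: "disparate_selection E (X - W) ?G t"
        using IH[OF card(2) fin'(2) W(3)] by blast
      show ?thesis
        using s t W(2) by (rule disparate_selection_sub_compl)
    qed
  qed
qed

theorem theorem6p7:
  fixes X :: "'a set" and E :: "'a set set" and Y :: "'b set" and F :: "'a \<Rightarrow> 'b set"
  assumes "finite X" and "X \<noteq> {}"
    and "simple_graph X E"
    and "finite Y"
    and "\<forall>x\<in>X. F x \<subseteq> Y"
  shows "gen_hall E Y X F \<longleftrightarrow> (\<exists>s. disparate_selection E X F s)"
  using gen_hall_if_disparate_selection[OF assms(1,2,5)]
    disparate_selection_if_gen_hall[OF assms(1,2,4,5)]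
  by blast

end
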